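(* Let $\mathbf r=(r_1,r_2,r_3)\in\mathcal R$ and write $U_{\mathbf r}(t)=\prod_{\nu=1}^3(a_\nu t+b_\nu)$ with $a_\nu=r_\nu\sigma_3$ and $b_\nu=r_\nu\ell+1$. Then for $t\in\mathbb Z$: (i) If $\mathbf r=(1,2,3)$, then $U_{\mathbf r}(0)=1$, $\ell=0$ and $b_\nu=1$ for $\nu=1,2,3$ (and these properties are equivalent). Moreover in this case $U_{\mathbf r}(t)\equiv1\pmod{2\sigma_3^2}$ for all $t\in\mathbb Z$, and $U_{\mathbf r}(t)\equiv1\pmod{\sigma_3^3}$ whenever $t\not\equiv-1\pmod 3$. In particular $U_{\mathbf r}(t)$ is odd and $U_{\mathbf r}(t)\equiv1\pmod 8$. (ii) If $\mathbf r\ne(1,2,3)$, then $\ell\ne0$, $b_\nu\ne1$ ($\nu=1,2,3$), and $U_{\mathbf r}(0)\equiv1\pmod{\sigma_3\ell}$, $U_{\mathbf r}(1)\equiv1\pmod{\sigma_3(\sigma_3+\ell)}$, $U_{\mathbf r}(t)\equiv1\pmod{\sigma_3\gcd(\sigma_3,\ell)}$ for all $t\in\mathbb Z$. In particular, if $\sigma_3$ is even, then $U_{\mathbf r}(t)$ is odd and $U_{\mathbf r}(t)\equiv1\pmod4$. If $\sigma_3$ is odd, then $U_{\mathbf r}(t)\equiv\delta(t)\pmod2$ and $U_{\mathbf r}(t)\equiv1\pmod{2^{\delta(t)}\sigma_3\gcd(\sigma_3,\ell)}$, where $\delta(t)=1$ if $t\equiv\ell\pmod2$ and $\delta(t)=0$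 otherwise.
   Context: $\mathcal R$ is the set of triples $\mathbf r=(r_1,r_2,r_3)$ of pairwise coprime positive integers with $r_1<r_2<r_3$. For $\mathbf r\in\mathcal R$ put $\sigma_1=r_1+r_2+r_3$, $\sigma_2=r_1r_2+r_1r_3+r_2r_3$, $\sigma_3=r_1r_2r_3$, and let $\ell$ be the unique integer with $0\le\ell<\sigma_3$ and $\ell\sigma_2\equiv-\sigma_1\pmod{\sigma_3}$ ($\sigma_2$ is invertible modulo $\sigma_3$). Define $U_{\mathbf r}(t)=\prod_{\nu=1}^3\bigl(r_\nu(\sigma_3t+\ell)+1\bigr)$. *)

theory Defs
  imports "HOL-Number_Theory.Cong"
begin

definition triples :: "(int \<times> int \<times> int) set" where
  "triples = {(r1, r2, r3). 0 < r1 \<and> r1 < r2 \<and> r2 < r3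
      \<and> coprime r1 r2 \<and> coprime r1 r3 \<and> coprime r2 r3}"

(* The components r_1, r_2, r_3; only used for \<nu> in {1..3}. *)
fun component :: "int \<times> int \<times> int \<Rightarrow> nat \<Rightarrow> int" where
  "component (r1, r2, r3) \<nu> = (if \<nu> = 1 then r1 else if \<nu> = 2 then r2 else r3)"

fun sigma1 :: "int \<times> int \<times> int \<Rightarrow> int" where
  "sigma1 (r1, r2, r3) = r1 + r2 + r3"

fun sigma2 :: "int \<times> int \<times> int \<Rightarrow> int" where
  "sigma2 (r1, r2, r3) = r1 * r2 + r1 * r3 + r2 * r3"

fun sigma3 :: "int \<times> int \<times> int \<Rightarrow> int" where
  "sigma3 (r1, r2, r3) = r1 * r2 * r3"

(* Meaningful for r in triples: see ell_ex1 below. *)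
definition ell :: "int \<times> int \<times> int \<Rightarrow> int" where
  "ell r = (THE l. 0 \<le> l \<and> l < sigma3 r \<and> [l * sigma2 r = - sigma1 r] (mod sigma3 r))"

definition U :: "int \<times> int \<times> int \<Rightarrow> int \<Rightarrow> int" where
  "U r t = (\<Prod>\<nu>=1..3. (component r \<nu> * (sigma3 r * t + ell r) + 1))"

definition coeff_a :: "int \<times> int \<times> int \<Rightarrow> nat \<Rightarrow> int" where
  "coeff_a r \<nu> = component r \<nu> * sigma3 r"

definition coeff_b :: "int \<times> int \<times> int \<Rightarrow> nat \<Rightarrow> int" where
  "coeff_b r \<nu> = component r \<nu> * ell r + 1"

definition delta :: "int \<times> int \<times> int \<Rightarrow> int \<Rightarrow> nat" where
  "delta r t = (if [t = ell r] (mod 2) then 1 else 0)"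

lemma coprime_sigma2_sigma3:
  assumes "r \<in> triples"
  shows "coprime (sigma2 r) (sigma3 r)"
proof -
  obtain r1 r2 r3 where r: "r = (r1, r2, r3)" by (cases r)
  have c: "coprime r1 r2" "coprime r1 r3" "coprime r2 r3"
    using assms by (auto simp: triples_def r)
  have "gcd r1 (sigma2 r) = gcd r1 (r2 * r3)" "gcd r2 (sigma2 r) = gcd r2 (r1 * r3)"
    "gcd r3 (sigma2 r) = gcd r3 (r1 * r2)"
    using gcd_add_mult[of r1 "r2 + r3" "r2 * r3"] gcd_add_mult[of r2 "r1 + r3" "r1 * r3"]
      gcd_add_mult[of r3 "r1 + r2" "r1 * r2"]
    by (simp_all add: r algebra_simps)
  moreover have "coprime r1 (r2 * r3)" "coprime r2 (r1 * r3)" "coprime r3 (r1 * r2)"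
    using c by (simp_all add: coprime_commute)
  ultimately have "coprime r1 (sigma2 r)" "coprime r2 (sigma2 r)" "coprime r3 (sigma2 r)"
    by (simp_all only: coprime_iff_gcd_eq_1)
  then have "coprime (r1 * r2 * r3) (sigma2 r)"
    by simp
  then show ?thesis
    by (simp add: r coprime_commute)
qed

lemma ell_ex1:
  assumes "r \<in> triples"
  shows "\<exists>!l. 0 \<le> l \<and> l < sigma3 r \<and> [l * sigma2 r = - sigma1 r] (mod sigma3 r)"
proof -
  have pos: "0 < sigma3 r"
    using assms by (auto simp: triples_def)
  have cop: "coprime (sigma2 r) (sigma3 r)"
    by (rule coprime_sigma2_sigma3[OF assms])
  obtain x where x: "[sigma2 r * x = 1] (mod sigma3 r)"
    using cong_solve_coprime_int[OF cop] by blast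
  let ?l = "(- sigma1 r * x) mod sigma3 r"
  have "[?l * sigma2 r = - sigma1 r * x * sigma2 r] (mod sigma3 r)"
    by (intro cong_mult) (simp_all add: cong_def)
  also have "- sigma1 r * x * sigma2 r = - sigma1 r * (sigma2 r * x)"
    by simp
  also have "[\<dots> = - sigma1 r * 1] (mod sigma3 r)"
    by (intro cong_mult x) simp
  finally have ex: "[?l * sigma2 r = - sigma1 r] (mod sigma3 r)"
    by simp
  show ?thesis
  proof (rule ex1I[of _ ?l])
    show "0 \<le> ?l \<and> ?l < sigma3 r \<and> [?l * sigma2 r = - sigma1 r] (mod sigma3 r)"
      using pos ex by simp
  next
    fix l
    assume l: "0 \<le> l \<and> l < sigma3 r \<and> [l * sigma2 r = - sigma1 r] (mod sigma3 r)"
    then have "[l * sigma2 r = ?l * sigma2 r] (mod sigma3 r)"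
      using ex by (metis cong_trans cong_sym)
    then have "[l = ?l] (mod sigma3 r)"
      using cong_mult_rcancel[OF cop] by blast
    then show "l = ?l"
      using l pos by (simp add: cong_def)
  qed
qed

end

theory Submission
  imports Defs
begin

text \<open>
  Put \<open>n = \<sigma>\<^sub>3 t + \<ell>\<close>. Then \<open>U(t) - 1 = n (\<sigma>\<^sub>3 n\<^sup>2 + \<sigma>\<^sub>2 n + \<sigma>\<^sub>1)\<close>, and the choice of \<open>\<ell>\<close> makes the second
  factor divisible by \<open>\<sigma>\<^sub>3\<close>, so \<open>U(t) \<equiv> 1 (mod \<sigma>\<^sub>3 n)\<close>; all congruences of part (ii) are read off from
  this one together with parity. Moreover \<open>\<ell> = 0\<close> iff \<open>\<sigma>\<^sub>3\<close> divides \<open>\<sigma>\<^sub>1\<close>, and as \<open>\<sigma>\<^sub>1 < 3 r\<^sub>3\<close> this forces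
  \<open>r\<^sub>1 r\<^sub>2 < 3\<close>, which leaves only the triple \<open>(1, 2, 3)\<close>.
\<close>

lemma prod_1_to_3: "(\<Prod>\<nu>=1..3::nat. f \<nu>) = f 1 * f 2 * (f 3 :: 'a :: comm_monoid_mult)"
  by (simp add: numeral_3_eq_3 numeral_2_eq_2 prod.atLeast_Suc_atMost)

lemma
  assumes "r \<in> triples"
  shows ell_nonneg: "0 \<le> ell r"
    and ell_less: "ell r < sigma3 r"
    and ell_cong: "[ell r * sigma2 r = - sigma1 r] (mod sigma3 r)"
  using theI'[OF ell_ex1[OF assms]] unfolding ell_def by blast+

text \<open>Expanding the product of the \<open>r\<^sub>\<nu> n + 1\<close> gives the elementary
  symmetric polynomials of the triple as coefficients of the powers of \<open>n\<close>.\<close>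

lemma U_eq:
  fixes r :: "int \<times> int \<times> int" and t :: int
  defines "n \<equiv> sigma3 r * t + ell r"
  shows "U r t = 1 + n * (sigma3 r * n\<^sup>2 + sigma2 r * n + sigma1 r)"
proof -
  obtain r1 r2 r3 where r: "r = (r1, r2, r3)" by (cases r)
  have "U r t = (r1 * n + 1) * (r2 * n + 1) * (r3 * n + 1)"
    unfolding U_def n_def[symmetric] prod_1_to_3 by (simp add: r)
  then show ?thesis by (simp add: r algebra_simps power2_eq_square)
qed

lemma U_cong_1:
  assumes "r \<in> triples"
  shows "[U r t = 1] (mod sigma3 r * (sigma3 r * t + ell r))"
proof -
  define n where "n = sigma3 r * t + ell r"
  have "sigma3 r dvd ell r * sigma2 r + sigma1 r"
    using ell_cong[OF assms] by (simp add: cong_iff_dvd_diff)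
  \<comment> \<open>Modulo \<open>sigma3 r\<close> the cubic term drops out and \<open>n\<close> may
    be replaced by \<open>ell r\<close>.\<close>
  then have "sigma3 r dvd sigma3 r * (n\<^sup>2 + sigma2 r * t) + (ell r * sigma2 r + sigma1 r)"
    by simp
  also have "\<dots> = sigma3 r * n\<^sup>2 + sigma2 r * n + sigma1 r"
    by (simp add: n_def algebra_simps)
  finally have "sigma3 r * n dvd n * (sigma3 r * n\<^sup>2 + sigma2 r * n + sigma1 r)"
    by (metis dvd_refl mult.commute mult_dvd_mono)
  then show ?thesis
    by (simp add: U_eq cong_iff_dvd_diff n_def)
qed

lemma sigma3_dvd_sigma1_iff:
  assumes "r \<in> triples"
  shows "sigma3 r dvd sigma1 r \<longleftrightarrow> r = (1, 2, 3)"
proof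
  assume dvd: "sigma3 r dvd sigma1 r"
  obtain r1 r2 r3 where r: "r = (r1, r2, r3)" by (cases r)
  have lt: "0 < r1" "r1 < r2" "r2 < r3" using assms by (auto simp: triples_def r)
  have "r1 * r2 * r3 \<le> r1 + r2 + r3"
    using zdvd_imp_le[OF dvd] lt by (simp add: r)
  also have "\<dots> < 3 * r3" using lt by simp
  finally have lt3: "r1 * r2 < 3" using lt by (simp add: mult_less_cancel_right)
  moreover have "r1 * 2 \<le> r1 * r2" using lt by (intro mult_left_mono) auto
  ultimately have r1: "r1 = 1" using lt by linarith
  then have r2: "r2 = 2" using lt lt3 by simp
  have "r3 dvd 3 + r3" using dvd by (auto simp: r r1 r2 dest: dvd_mult_right)
  then have "r3 dvd 3" by simp
  then have "r3 \<le> 3" by (rule zdvd_imp_le) simp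
  then show "r = (1, 2, 3)" using lt r r1 r2 by simp
qed simp

text \<open>In the range from 0 to \<open>sigma3 r - 1\<close> only 0 is divisible by
  \<open>sigma3 r\<close>. Multiplying by the unit \<open>sigma2 r\<close> preserves divisibility
  and turns \<open>ell r\<close> into \<open>- sigma1 r\<close>.\<close>

lemma ell_eq_0_iff:
  assumes "r \<in> triples"
  shows "ell r = 0 \<longleftrightarrow> r = (1, 2, 3)"
proof -
  have "ell r = 0 \<longleftrightarrow> sigma3 r dvd ell r"
    using ell_nonneg[OF assms] ell_less[OF assms] by (auto dest: zdvd_imp_le)
  also have "\<dots> \<longleftrightarrow> sigma3 r dvd ell r * sigma2 r"
    using coprime_sigma2_sigma3[OF assms] by (simp add: coprime_dvd_mult_left_iff coprime_commute)
  also have "\<dots> \<longleftrightarrow> sigma3 r dvd sigma1 r"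
    using ell_cong[OF assms] by (metis cong_iff_dvd_diff diff_minus_eq_add dvd_add_left_iff dvd_add_right_iff)
  finally show ?thesis using sigma3_dvd_sigma1_iff[OF assms] by simp
qed

text \<open>At \<open>t = 0\<close> one has \<open>n = ell r \<ge> 0\<close>, so the second factor
  of \<open>U r 0 - 1\<close> is positive and only the factor \<open>ell r\<close> can
  vanish.\<close>

lemma U_0_eq_1_iff:
  assumes "r \<in> triples"
  shows "U r 0 = 1 \<longleftrightarrow> ell r = 0"
proof -
  have "0 < sigma1 r" "0 < sigma2 r" "0 < sigma3 r"
    using assms by (auto simp: triples_def intro!: add_pos_pos)
  then have "0 < sigma3 r * (ell r)\<^sup>2 + sigma2 r * ell r + sigma1 r"
    using ell_nonneg[OF assms] by (simp add: add_nonneg_pos)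
  then show ?thesis by (simp add: U_eq)
qed

lemma coeff_b_eq_1_iff:
  assumes "r \<in> triples"
  shows "coeff_b r \<nu> = 1 \<longleftrightarrow> ell r = 0"
proof -
  \<comment> \<open>Every index other than 1 and 2 falls through to the third entry, so this holds
    for all \<nu>.\<close>
  have "component r \<nu> \<noteq> 0" using assms by (cases r) (auto simp: triples_def)
  then show ?thesis by (simp add: coeff_b_def)
qed

lemma U_eq_prod_coeff: "U r t = (\<Prod>\<nu>=1..3. (coeff_a r \<nu> * t + coeff_b r \<nu>))"
  by (simp add: U_def coeff_a_def coeff_b_def algebra_simps)

text \<open>Here \<open>sigma3 r = 6\<close>, so the moduli are \<open>2 * 6\<^sup>2\<close> and
  \<open>6\<^sup>3\<close>. As \<open>n = 6 * t\<close>, a factor 36 splits off, and it remains to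
  find the factors 2 and 3 in the cofactor.\<close>

lemma
  fixes t :: int
  shows U_123_cong_72: "[U (1, 2, 3) t = 1] (mod 72)"
    and U_123_cong_216: "\<not> [t = - 1] (mod 3) \<Longrightarrow> [U (1, 2, 3) t = 1] (mod 216)"
proof -
  have "(1, 2, 3) \<in> triples" by (simp add: triples_def coprime_iff_gcd_eq_1 gcd_non_0_int)
  then have "ell (1, 2, 3) = 0" by (simp add: ell_eq_0_iff)
  then have eq: "U (1, 2, 3) t - 1 = 36 * (t * (36 * t\<^sup>2 + 11 * t + 1))"
    by (simp add: U_eq algebra_simps power2_eq_square)
  have even: "2 dvd t * (36 * t\<^sup>2 + 11 * t + 1)" by auto
  then have "36 * 2 dvd U (1, 2, 3) t - 1" unfolding eq by (rule mult_dvd_mono[OF dvd_refl])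
  then show "[U (1, 2, 3) t = 1] (mod 72)" by (simp add: cong_iff_dvd_diff)
  show "[U (1, 2, 3) t = 1] (mod 216)" if "\<not> [t = - 1] (mod 3)"
  proof -
    have "3 dvd t \<or> 3 dvd t - 1" using that by (simp add: cong_iff_dvd_diff) presburger
    \<comment> \<open>Modulo 3 the quadratic is \<open>- (t - 1)\<close>, so it covers the residue 1
      while \<open>t\<close> itself covers 0.\<close>
    then have "3 dvd t \<or> 3 dvd 3 * (12 * t\<^sup>2 + 4 * t) - (t - 1)"
      by (metis dvd_diff dvd_triv_left)
    also have "3 * (12 * t\<^sup>2 + 4 * t) - (t - 1) = 36 * t\<^sup>2 + 11 * t + 1" by simp
    finally have "3 dvd t * (36 * t\<^sup>2 + 11 * t + 1)" by auto
    moreover have "2 dvd m \<Longrightarrow> 3 dvd m \<Longrightarrow> 2 * 3 dvd m" for m :: int by presburger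
    ultimately have "2 * 3 dvd t * (36 * t\<^sup>2 + 11 * t + 1)" using even by blast
    then have "36 * (2 * 3) dvd U (1, 2, 3) t - 1" unfolding eq by (rule mult_dvd_mono[OF dvd_refl])
    then show ?thesis by (simp add: cong_iff_dvd_diff)
  qed
qed

lemma even_ell:
  assumes "r \<in> triples" and "even (sigma3 r)"
  shows "even (ell r)"
proof -
  \<comment> \<open>By coprimality exactly one entry is even, so the sum contains two odd
    entries.\<close>
  have "even (sigma1 r)"
    using assms by (cases r) (auto simp: triples_def dest: coprime_common_divisor)
  moreover have "odd (sigma2 r)"
    using coprime_sigma2_sigma3[OF assms(1)] assms(2) by (auto dest: coprime_common_divisor)
  moreover have "[ell r * sigma2 r = - sigma1 r] (mod 2)"
    using ell_cong[OF assms(1)] assms(2) by (rule cong_dvd_modulus)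
  then have "even (ell r * sigma2 r) \<longleftrightarrow> even (sigma1 r)"
    by (metis cong_dvd_iff dvd_minus_iff)
  ultimately show ?thesis by simp
qed

lemma U_cong_1_mod_4:
  assumes "r \<in> triples" and "even (sigma3 r)"
  shows "[U r t = 1] (mod 4)"
proof -
  have "2 * 2 dvd sigma3 r * (sigma3 r * t + ell r)"
    using assms even_ell[OF assms] by (intro mult_dvd_mono) auto
  then show ?thesis using cong_dvd_modulus[OF U_cong_1[OF assms(1)]] by simp
qed

text \<open>The gcd divides \<open>sigma3 r * t + ell r\<close> for every \<open>t\<close>.\<close>

lemma U_cong_1_gcd:
  assumes "r \<in> triples"
  shows "[U r t = 1] (mod sigma3 r * gcd (sigma3 r) (ell r))"
  by (rule cong_dvd_modulus[OF U_cong_1[OF assms]]) simp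

text \<open>All three symmetric functions are odd, so modulo 2 the second factor of
  \<open>U r t - 1\<close> is \<open>n\<^sup>2 + n + 1\<close>, which is always odd. Hence
  \<open>U r t - 1\<close> has the parity of \<open>n\<close>, that is, of
  \<open>t + ell r\<close>.\<close>

lemma odd_U_iff:
  assumes "odd (sigma3 r)"
  shows "odd (U r t) \<longleftrightarrow> [t = ell r] (mod 2)"
proof -
  have "odd (sigma1 r)" "odd (sigma2 r)" using assms by (cases r; simp)+
  moreover have "[t = ell r] (mod 2) \<longleftrightarrow> even (t + ell r)"
    by (simp add: cong_iff_dvd_diff)
  ultimately show ?thesis using assms by (auto simp: U_eq)
qed

lemma U_cong_delta:
  assumes "odd (sigma3 r)"
  shows "[U r t = int (delta r t)] (mod 2)"
  using odd_U_iff[OF assms, of t] by (auto simp: delta_def cong_iff_dvd_diff)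

text \<open>The modulus from \<open>U_cong_1_gcd\<close> is odd, so it combines with the congruence
  modulo 2 that holds when \<open>delta r t = 1\<close>.\<close>

lemma U_cong_1_delta_gcd:
  assumes "r \<in> triples" and "odd (sigma3 r)"
  shows "[U r t = 1] (mod 2 ^ delta r t * sigma3 r * gcd (sigma3 r) (ell r))"
proof (cases "[t = ell r] (mod 2)")
  case True
  have "odd (gcd (sigma3 r) (ell r))" using assms(2) by (meson dvd_trans gcd_dvd1)
  then have "coprime 2 (sigma3 r * gcd (sigma3 r) (ell r))" using assms(2) by simp
  moreover have "[U r t = 1] (mod 2)" using True odd_U_iff[OF assms(2)] by (simp add: cong_iff_dvd_diff)
  ultimately have "[U r t = 1] (mod 2 * (sigma3 r * gcd (sigma3 r) (ell r)))"
    using U_cong_1_gcd[OF assms(1)] by (metis coprime_cong_mult)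
  then show ?thesis using True by (simp add: delta_def mult.assoc)
next
  case False
  then show ?thesis using U_cong_1_gcd[OF assms(1)] by (simp add: delta_def)
qed

theorem theorem4p3:
  fixes r :: "int \<times> int \<times> int"
  assumes "r \<in> triples"
  shows
    "(\<forall>t. U r t = (\<Prod>\<nu>=1..3. (coeff_a r \<nu> * t + coeff_b r \<nu>))) \<and>
     (r = (1, 2, 3) \<longleftrightarrow> U r 0 = 1) \<and>
     (U r 0 = 1 \<longleftrightarrow> ell r = 0) \<and>
     (ell r = 0 \<longleftrightarrow> (\<forall>\<nu>\<in>{1..3}. coeff_b r \<nu> = 1)) \<and>
     (r = (1, 2, 3) \<longrightarrow>
        U r 0 = 1 \<and> ell r = 0 \<and> (\<forall>\<nu>\<in>{1..3}. coeff_b r \<nu> = 1) \<and>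
        (\<forall>t. [U r t = 1] (mod 2 * sigma3 r ^ 2)) \<and>
        (\<forall>t. \<not> [t = - 1] (mod 3) \<longrightarrow> [U r t = 1] (mod sigma3 r ^ 3)) \<and>
        (\<forall>t. odd (U r t) \<and> [U r t = 1] (mod 8))) \<and>
     (r \<noteq> (1, 2, 3) \<longrightarrow>
        ell r \<noteq> 0 \<and> (\<forall>\<nu>\<in>{1..3}. coeff_b r \<nu> \<noteq> 1) \<and>
        [U r 0 = 1] (mod sigma3 r * ell r) \<and>
        [U r 1 = 1] (mod sigma3 r * (sigma3 r + ell r)) \<and>
        (\<forall>t. [U r t = 1] (mod sigma3 r * gcd (sigma3 r) (ell r))) \<and>
        (even (sigma3 r) \<longrightarrow> (\<forall>t. odd (U r t) \<and> [U r t = 1] (mod 4))) \<and>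
        (odd (sigma3 r) \<longrightarrow>
           (\<forall>t. [U r t = int (delta r t)] (mod 2) \<and>
                [U r t = 1] (mod 2 ^ delta r t * sigma3 r * gcd (sigma3 r) (ell r)))))"
proof (intro conjI impI)
  show "\<forall>t. U r t = (\<Prod>\<nu>=1..3. (coeff_a r \<nu> * t + coeff_b r \<nu>))"
    using U_eq_prod_coeff by blast
  show eq: "r = (1, 2, 3) \<longleftrightarrow> U r 0 = 1" "U r 0 = 1 \<longleftrightarrow> ell r = 0"
    "ell r = 0 \<longleftrightarrow> (\<forall>\<nu>\<in>{1..3}. coeff_b r \<nu> = 1)"
    \<comment> \<open>The witness 1 shows that the index range is nonempty, so that the condition on
      all \<open>coeff_b r \<nu>\<close> does force \<open>ell r = 0\<close>.\<close>
    using assms by (auto simp add: U_0_eq_1_iff ell_eq_0_iff coeff_b_eq_1_iff intro: exI[of _ 1])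
  {
    assume r: "r = (1, 2, 3)"
    show "U r 0 = 1" "ell r = 0" "\<forall>\<nu>\<in>{1..3}. coeff_b r \<nu> = 1"
      using eq r by blast+
    show "\<forall>t. [U r t = 1] (mod 2 * sigma3 r ^ 2)"
      using U_123_cong_72 by (simp add: r)
    show "\<forall>t. \<not> [t = - 1] (mod 3) \<longrightarrow> [U r t = 1] (mod sigma3 r ^ 3)"
      using U_123_cong_216 by (simp add: r)
    have "[U r t = 1] (mod 8)" for t
      using cong_dvd_modulus[OF U_123_cong_72, of 8] by (simp add: r)
    moreover have "odd (U r t)" for t
      using cong_dvd_iff[OF cong_dvd_modulus[OF U_123_cong_72, of 2], of t] by (simp add: r)
    ultimately show "\<forall>t. odd (U r t) \<and> [U r t = 1] (mod 8)" by blast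
  next
    assume r: "r \<noteq> (1, 2, 3)"
    show "ell r \<noteq> 0" "\<forall>\<nu>\<in>{1..3}. coeff_b r \<nu> \<noteq> 1"
      using assms r by (simp_all add: ell_eq_0_iff coeff_b_eq_1_iff)
    show "[U r 0 = 1] (mod sigma3 r * ell r)" "[U r 1 = 1] (mod sigma3 r * (sigma3 r + ell r))"
      using U_cong_1[OF assms, of 0] U_cong_1[OF assms, of 1] by simp_all
    show "\<forall>t. [U r t = 1] (mod sigma3 r * gcd (sigma3 r) (ell r))"
      using U_cong_1_gcd[OF assms] by blast
    show "\<forall>t. odd (U r t) \<and> [U r t = 1] (mod 4)" if "even (sigma3 r)"
    proof (intro allI conjI)
      fix t
      show cong: "[U r t = 1] (mod 4)" using U_cong_1_mod_4[OF assms that] .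
      show "odd (U r t)" using cong_dvd_iff[OF cong_dvd_modulus[OF cong, of 2]] by simp
    qed
    show "\<forall>t. [U r t = int (delta r t)] (mod 2) \<and>
        [U r t = 1] (mod 2 ^ delta r t * sigma3 r * gcd (sigma3 r) (ell r))" if "odd (sigma3 r)"
      using U_cong_delta U_cong_1_delta_gcd assms that by blast
  }
qed

end
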